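(* Let $0\le a<b\le1$, let $\mathsf f,\mathsf u_d\in L^2(\Omega)$, and let $\varphi\in C^2(a,b)$ be a nonnegative convex function with $\lim_{s\downarrow a}\varphi(s)=+\infty=\lim_{s\uparrow b}\varphi(s)$. Then there exists an optimal pair $(\bar s,\bar{\mathsf u}(\bar s))\in(a,b)\times\mathbb H^{\bar s}(\Omega)$ for the problem of minimizing $$J(s,\mathsf u)=\tfrac12\|\mathsf u-\mathsf u_d\|_{L^2(\Omega)}^2+\varphi(s)$$ over $s\in(a,b)$ subject to the state equation $(-\Delta)^s\mathsf u=\mathsf f$ in $\Omega$; that is, there is $\bar s\in(a,b)$ such that $\bar{\mathsf u}(\bar s)=\mathcal S(\bar s)\in\mathbb H^{\bar s}(\Omega)$ and $f(\bar s)\le f(s)$ for all $s\in(a,b)$.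
   Context: $\Omega\subset\mathbb R^n$ ($n\ge1$) is an open, bounded, convex polytopal domain. $\{(\lambda_k,\varphi_k)\}_{k\in\mathbb N}$ are the eigenpairs of the Dirichlet Laplacian on $\Omega$ with $\{\varphi_k\}$ an orthonormal basis of $L^2(\Omega)$ (not to be confused with the function $\varphi$). For $s\in(0,1)$: $\mathbb H^s(\Omega)=\{w=\sum_kw_k\varphi_k\in L^2(\Omega):\sum_k\lambda_k^sw_k^2<\infty\}$, and $(-\Delta)^sw=\sum_k\lambda_k^sw_k\varphi_k$ with $w_k=(w,\varphi_k)_{L^2(\Omega)}$. The control to state map is $\mathcal S(s)=\sum_k\lambda_k^{-s}\mathsf f_k\varphi_k$ with $\mathsf f_k=(\mathsf f,\varphi_k)_{L^2(\Omega)}$, i.e. $\mathcal S(s)$ is the solution of $(-\Delta)^s\mathsf u=\mathsf f$. The reduced cost is $f(s)=J(s,\mathcal S(s))$ for $s\in(a,b)$. *)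

theory Defs
  imports "HOL-Analysis.Analysis"
begin

text \<open>Elements of Lebesgue and Sobolev spaces are represented by functions on the whole space;
  only their values almost everywhere on \<open>\<Omega>\<close> matter, and two functions that agree almost
  everywhere on \<open>\<Omega>\<close> represent the same element.\<close>

definition L2 :: "'a::euclidean_space set \<Rightarrow> ('a \<Rightarrow> 'b::euclidean_space) set" where
  "L2 \<Omega> = {u. u \<in> borel_measurable (lebesgue_on \<Omega>) \<and>
              integrable (lebesgue_on \<Omega>) (\<lambda>x. (norm (u x))\<^sup>2)}"

definition L2_inner ::
  "'a::euclidean_space set \<Rightarrow> ('a \<Rightarrow> 'b::euclidean_space) \<Rightarrow> ('a \<Rightarrow> 'b) \<Rightarrow> real" where
  "L2_inner \<Omega> u v = (LINT x|lebesgue_on \<Omega>. u x \<bullet> v x)"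

definition L2_norm :: "'a::euclidean_space set \<Rightarrow> ('a \<Rightarrow> 'b::euclidean_space) \<Rightarrow> real" where
  "L2_norm \<Omega> u = sqrt (L2_inner \<Omega> u u)"

primrec Ck :: "nat \<Rightarrow> ('a::euclidean_space \<Rightarrow> real) \<Rightarrow> bool" where
  "Ck 0 u \<longleftrightarrow> continuous_on UNIV u"
| "Ck (Suc k) u \<longleftrightarrow> (\<forall>x. u differentiable (at x)) \<and>
      (\<forall>i\<in>Basis. Ck k (\<lambda>x. frechet_derivative u (at x) i))"

text \<open>The space of infinitely differentiable functions with compact support in \<open>\<Omega>\<close>,
  extended by zero outside \<open>\<Omega>\<close>.\<close>

definition test_functions :: "'a::euclidean_space set \<Rightarrow> ('a \<Rightarrow> real) set" where
  "test_functions \<Omega> = {\<psi>. (\<forall>k. Ck k \<psi>) \<and>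
      compact (closure {x. \<psi> x \<noteq> 0}) \<and> closure {x. \<psi> x \<noteq> 0} \<subseteq> \<Omega>}"

definition grad :: "('a::euclidean_space \<Rightarrow> real) \<Rightarrow> 'a \<Rightarrow> 'a" where
  "grad \<psi> x = (\<Sum>i\<in>Basis. frechet_derivative \<psi> (at x) i *\<^sub>R i)"

text \<open>\<open>u\<close> lies in the Sobolev space \<open>H\<^sup>1(\<Omega>)\<close> and has weak gradient \<open>G\<close>,
  which is determined up to a null set.\<close>

definition weak_gradient ::
  "'a::euclidean_space set \<Rightarrow> ('a \<Rightarrow> real) \<Rightarrow> ('a \<Rightarrow> 'a) \<Rightarrow> bool" where
  "weak_gradient \<Omega> u G \<longleftrightarrow> u \<in> L2 \<Omega> \<and> G \<in> L2 \<Omega> \<and>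
     (\<forall>\<psi>\<in>test_functions \<Omega>. \<forall>i\<in>Basis.
        (LINT x|lebesgue_on \<Omega>. u x * (grad \<psi> x \<bullet> i)) =
        - (LINT x|lebesgue_on \<Omega>. (G x \<bullet> i) * \<psi> x))"

text \<open>\<open>H\<^sub>0\<^sup>1(\<Omega>)\<close>: closure of the test functions in \<open>H\<^sup>1(\<Omega>)\<close>.\<close>

definition H10 :: "'a::euclidean_space set \<Rightarrow> ('a \<Rightarrow> real) set" where
  "H10 \<Omega> = {u. \<exists>G \<psi>. weak_gradient \<Omega> u G \<and> (\<forall>n::nat. \<psi> n \<in> test_functions \<Omega>) \<and>
      (\<lambda>n. L2_norm \<Omega> (\<lambda>x. \<psi> n x - u x)) \<longlonglongrightarrow> 0 \<and>
      (\<lambda>n. L2_norm \<Omega> (\<lambda>x. grad (\<psi> n) x - G x)) \<longlonglongrightarrow> 0}"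

text \<open>Weak form of \<open>- \<Delta> e = \<mu> e\<close> in \<open>\<Omega>\<close>, \<open>e = 0\<close> on the boundary of \<open>\<Omega>\<close>.\<close>

definition dirichlet_eigenpair ::
  "'a::euclidean_space set \<Rightarrow> real \<Rightarrow> ('a \<Rightarrow> real) \<Rightarrow> bool" where
  "dirichlet_eigenpair \<Omega> \<mu> e \<longleftrightarrow> e \<in> H10 \<Omega> \<and> \<not> (AE x in lebesgue_on \<Omega>. e x = 0) \<and>
     (\<forall>v\<in>H10 \<Omega>. \<forall>G H. weak_gradient \<Omega> e G \<longrightarrow> weak_gradient \<Omega> v H \<longrightarrow>
        L2_inner \<Omega> G H = \<mu> * L2_inner \<Omega> e v)"

text \<open>Convergence in \<open>L\<^sup>2(\<Omega>)\<close> of the series with terms \<open>c k\<close> times \<open>e k\<close> to \<open>w\<close>.\<close>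

definition L2_sums ::
  "'a::euclidean_space set \<Rightarrow> (nat \<Rightarrow> real) \<Rightarrow> (nat \<Rightarrow> 'a \<Rightarrow> real) \<Rightarrow> ('a \<Rightarrow> real) \<Rightarrow> bool" where
  "L2_sums \<Omega> c e w \<longleftrightarrow> w \<in> L2 \<Omega> \<and>
     (\<lambda>n. L2_norm \<Omega> (\<lambda>x. (\<Sum>k<n. c k * e k x) - w x)) \<longlonglongrightarrow> 0"

definition L2_orthonormal_basis ::
  "'a::euclidean_space set \<Rightarrow> (nat \<Rightarrow> 'a \<Rightarrow> real) \<Rightarrow> bool" where
  "L2_orthonormal_basis \<Omega> e \<longleftrightarrow> (\<forall>k. e k \<in> L2 \<Omega>) \<and>
     (\<forall>j k. L2_inner \<Omega> (e j) (e k) = (if j = k then 1 else 0)) \<and>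
     (\<forall>w\<in>L2 \<Omega>. L2_sums \<Omega> (\<lambda>k. L2_inner \<Omega> w (e k)) e w)"

definition dirichlet_eigenbasis ::
  "'a::euclidean_space set \<Rightarrow> (nat \<Rightarrow> real) \<Rightarrow> (nat \<Rightarrow> 'a \<Rightarrow> real) \<Rightarrow> bool" where
  "dirichlet_eigenbasis \<Omega> lam e \<longleftrightarrow>
     (\<forall>k. dirichlet_eigenpair \<Omega> (lam k) (e k)) \<and> L2_orthonormal_basis \<Omega> e"

definition Hs :: "'a::euclidean_space set \<Rightarrow> (nat \<Rightarrow> real) \<Rightarrow> (nat \<Rightarrow> 'a \<Rightarrow> real) \<Rightarrow> real \<Rightarrow>
    ('a \<Rightarrow> real) set" where
  "Hs \<Omega> lam e s = {w\<in>L2 \<Omega>. L2_sums \<Omega> (\<lambda>k. L2_inner \<Omega> w (e k)) e w \<and>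
      summable (\<lambda>k. lam k powr s * (L2_inner \<Omega> w (e k))\<^sup>2)}"

text \<open>The graph of the spectral fractional Laplacian: \<open>(- \<Delta>)\<^sup>s w = g\<close>. Only \<open>g\<close> in
  \<open>L\<^sup>2(\<Omega>)\<close> is considered. For such \<open>g\<close>, equality in the dual of \<open>H\<^sup>s(\<Omega>)\<close> says that all
  coefficients agree, and then the series converges to \<open>g\<close> in \<open>L\<^sup>2(\<Omega>)\<close>.\<close>

definition frac_laplacian :: "'a::euclidean_space set \<Rightarrow> (nat \<Rightarrow> real) \<Rightarrow>
    (nat \<Rightarrow> 'a \<Rightarrow> real) \<Rightarrow> real \<Rightarrow> ('a \<Rightarrow> real) \<Rightarrow> ('a \<Rightarrow> real) \<Rightarrow> bool" where
  "frac_laplacian \<Omega> lam e s w g \<longleftrightarrow> w \<in> Hs \<Omega> lam e s \<and>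
     L2_sums \<Omega> (\<lambda>k. lam k powr s * L2_inner \<Omega> w (e k)) e g"

text \<open>The control to state map; the choice is only among representatives that agree
  almost everywhere on \<open>\<Omega>\<close>.\<close>

definition control_to_state :: "'a::euclidean_space set \<Rightarrow> (nat \<Rightarrow> real) \<Rightarrow>
    (nat \<Rightarrow> 'a \<Rightarrow> real) \<Rightarrow> ('a \<Rightarrow> real) \<Rightarrow> real \<Rightarrow> 'a \<Rightarrow> real" where
  "control_to_state \<Omega> lam e f s =
     (SOME u. L2_sums \<Omega> (\<lambda>k. lam k powr (- s) * L2_inner \<Omega> f (e k)) e u)"

definition cost :: "'a::euclidean_space set \<Rightarrow> ('a \<Rightarrow> real) \<Rightarrow> (real \<Rightarrow> real) \<Rightarrow>
    real \<Rightarrow> ('a \<Rightarrow> real) \<Rightarrow> real" where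
  "cost \<Omega> ud \<phi> s u = 1/2 * (L2_norm \<Omega> (\<lambda>x. u x - ud x))\<^sup>2 + \<phi> s"

definition reduced_cost :: "'a::euclidean_space set \<Rightarrow> (nat \<Rightarrow> real) \<Rightarrow>
    (nat \<Rightarrow> 'a \<Rightarrow> real) \<Rightarrow> ('a \<Rightarrow> real) \<Rightarrow> ('a \<Rightarrow> real) \<Rightarrow> (real \<Rightarrow> real) \<Rightarrow> real \<Rightarrow> real" where
  "reduced_cost \<Omega> lam e f ud \<phi> s = cost \<Omega> ud \<phi> s (control_to_state \<Omega> lam e f s)"

definition admissible :: "'a::euclidean_space set \<Rightarrow> (nat \<Rightarrow> real) \<Rightarrow>
    (nat \<Rightarrow> 'a \<Rightarrow> real) \<Rightarrow> ('a \<Rightarrow> real) \<Rightarrow> real \<Rightarrow> real \<Rightarrow> real \<Rightarrow> ('a \<Rightarrow> real) \<Rightarrow> bool" where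
  "admissible \<Omega> lam e f a b s u \<longleftrightarrow>
     s \<in> {a<..<b} \<and> u \<in> Hs \<Omega> lam e s \<and> frac_laplacian \<Omega> lam e s u f"

definition optimal_pair :: "'a::euclidean_space set \<Rightarrow> (nat \<Rightarrow> real) \<Rightarrow>
    (nat \<Rightarrow> 'a \<Rightarrow> real) \<Rightarrow> ('a \<Rightarrow> real) \<Rightarrow> ('a \<Rightarrow> real) \<Rightarrow> (real \<Rightarrow> real) \<Rightarrow> real \<Rightarrow> real \<Rightarrow>
    real \<Rightarrow> ('a \<Rightarrow> real) \<Rightarrow> bool" where
  "optimal_pair \<Omega> lam e f ud \<phi> a b s u \<longleftrightarrow> admissible \<Omega> lam e f a b s u \<and>
     (\<forall>t v. admissible \<Omega> lam e f a b t v \<longrightarrow> cost \<Omega> ud \<phi> s u \<le> cost \<Omega> ud \<phi> t v)"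

definition C2_on :: "real set \<Rightarrow> (real \<Rightarrow> real) \<Rightarrow> bool" where
  "C2_on I \<phi> \<longleftrightarrow> (\<exists>\<phi>' \<phi>''. (\<forall>s\<in>I. (\<phi> has_real_derivative \<phi>' s) (at s within I)) \<and>
     (\<forall>s\<in>I. (\<phi>' has_real_derivative \<phi>'' s) (at s within I)) \<and> continuous_on I \<phi>'')"

end

theory Submission
  imports Defs
begin

text \<open>The state has the coefficients \<open>lam k powr (- s) * f\<^sub>k\<close>, so once the eigenvalues are bounded away
  from \<open>0\<close>, Parseval's identity turns the tracking term into a series of functions continuous in
  \<open>s\<close> that converges uniformly on \<open>[0, 1]\<close>. The reduced cost is thus continuous on \<open>(a, b)\<close>, and since
  \<open>\<phi>\<close> blows up at both ends, it attains its minimum. The lower bound for the eigenvalues is a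
  Poincare inequality on \<open>H\<^sub>0\<^sup>1\<close> of the bounded set \<open>\<Omega>\<close>; existence of the state is the completeness
  of \<open>L\<^sup>2(\<Omega>)\<close>.\<close>

subsection \<open>The space \<open>L\<^sup>2\<close>\<close>

lemma L2_measurable: "u \<in> L2 \<Omega> \<Longrightarrow> u \<in> borel_measurable (lebesgue_on \<Omega>)"
  by (simp add: L2_def)

lemma L2_integrable_norm_square: "u \<in> L2 \<Omega> \<Longrightarrow> integrable (lebesgue_on \<Omega>) (\<lambda>x. (norm (u x))\<^sup>2)"
  by (simp add: L2_def)

text \<open>Pointwise Cauchy-Schwarz followed by \<open>2 p q \<le> p^2 + q^2\<close> gives the
  integrable majorant. Every later splitting of an inner product rests on this
  integrability.\<close>

lemma L2_integrable_inner:
  assumes u: "u \<in> L2 \<Omega>" and v: "v \<in> L2 \<Omega>"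
  shows "integrable (lebesgue_on \<Omega>) (\<lambda>x. u x \<bullet> v x)"
proof (rule Bochner_Integration.integrable_bound)
  show "integrable (lebesgue_on \<Omega>) (\<lambda>x. (norm (u x))\<^sup>2 + (norm (v x))\<^sup>2)"
    using u v by (intro Bochner_Integration.integrable_add L2_integrable_norm_square)
  show "(\<lambda>x. u x \<bullet> v x) \<in> borel_measurable (lebesgue_on \<Omega>)"
    using u v by (intro borel_measurable_inner L2_measurable)
  have "norm (y \<bullet> z) \<le> norm ((norm y)\<^sup>2 + (norm z)\<^sup>2)" for y z :: 'b
  proof -
    have "norm (y \<bullet> z) \<le> norm y * norm z"
      by (simp add: Cauchy_Schwarz_ineq2)
    also have "\<dots> \<le> 2 * norm y * norm z" by simp
    also have "\<dots> \<le> (norm y)\<^sup>2 + (norm z)\<^sup>2" by (rule sum_squares_bound)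
    finally show ?thesis by simp
  qed
  then show "AE x in lebesgue_on \<Omega>. norm (u x \<bullet> v x) \<le> norm ((norm (u x))\<^sup>2 + (norm (v x))\<^sup>2)"
    by simp
qed

lemma L2_scaleR [intro]: "u \<in> L2 \<Omega> \<Longrightarrow> (\<lambda>x. c *\<^sub>R u x) \<in> L2 \<Omega>"
  by (auto simp: L2_def power_mult_distrib)

lemma L2_cmult [intro]: "u \<in> L2 \<Omega> \<Longrightarrow> (\<lambda>x. c * u x) \<in> L2 \<Omega>" for u :: "_ \<Rightarrow> real"
  using L2_scaleR[of u \<Omega> c] by simp

lemma L2_add [intro]:
  assumes "u \<in> L2 \<Omega>" "v \<in> L2 \<Omega>"
  shows "(\<lambda>x. u x + v x) \<in> L2 \<Omega>"
proof -
  have "integrable (lebesgue_on \<Omega>) (\<lambda>x. (norm (u x))\<^sup>2 + 2 * (u x \<bullet> v x) + (norm (v x))\<^sup>2)"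
    using assms by (intro Bochner_Integration.integrable_add L2_integrable_norm_square
        integrable_mult_right L2_integrable_inner)
  then have "integrable (lebesgue_on \<Omega>) (\<lambda>x. (norm (u x + v x))\<^sup>2)"
    by (simp add: power2_norm_eq_inner inner_simps inner_commute algebra_simps)
  then show ?thesis
    using assms by (auto simp: L2_def)
qed

lemma L2_diff [intro]:
  assumes "u \<in> L2 \<Omega>" "v \<in> L2 \<Omega>"
  shows "(\<lambda>x. u x - v x) \<in> L2 \<Omega>"
  using L2_add[OF assms(1) L2_scaleR[OF assms(2), of "-1"]] by simp

lemma L2_zero [simp]: "(\<lambda>x. 0) \<in> L2 \<Omega>"
  by (simp add: L2_def)

lemma L2_sum [intro]: "(\<And>k. k \<in> A \<Longrightarrow> u k \<in> L2 \<Omega>) \<Longrightarrow> (\<lambda>x. \<Sum>k\<in>A. u k x) \<in> L2 \<Omega>"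
  by (induction A rule: infinite_finite_induct) auto

lemma L2_inner_commute: "L2_inner \<Omega> u v = L2_inner \<Omega> v u"
  by (simp add: L2_inner_def inner_commute)

lemma L2_inner_scaleR_left: "L2_inner \<Omega> (\<lambda>x. c *\<^sub>R u x) v = c * L2_inner \<Omega> u v"
  by (simp add: L2_inner_def)

lemma L2_inner_cmult_left: "L2_inner \<Omega> (\<lambda>x. c * u x) v = c * L2_inner \<Omega> u v"
  by (simp add: L2_inner_def mult.assoc)

lemma L2_inner_diff_left:
  "u \<in> L2 \<Omega> \<Longrightarrow> v \<in> L2 \<Omega> \<Longrightarrow> w \<in> L2 \<Omega> \<Longrightarrow>
    L2_inner \<Omega> (\<lambda>x. u x - v x) w = L2_inner \<Omega> u w - L2_inner \<Omega> v w"
  unfolding L2_inner_def inner_diff_left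
  by (intro Bochner_Integration.integral_diff L2_integrable_inner)

lemma L2_inner_diff_right:
  "u \<in> L2 \<Omega> \<Longrightarrow> v \<in> L2 \<Omega> \<Longrightarrow> w \<in> L2 \<Omega> \<Longrightarrow>
    L2_inner \<Omega> w (\<lambda>x. u x - v x) = L2_inner \<Omega> w u - L2_inner \<Omega> w v"
  by (simp add: L2_inner_commute[of \<Omega> w] L2_inner_diff_left)

lemma L2_inner_sum_left:
  assumes "\<And>k. k \<in> A \<Longrightarrow> u k \<in> L2 \<Omega>" and "w \<in> L2 \<Omega>"
  shows "L2_inner \<Omega> (\<lambda>x. \<Sum>k\<in>A. u k x) w = (\<Sum>k\<in>A. L2_inner \<Omega> (u k) w)"
  unfolding L2_inner_def inner_sum_left
  by (intro Bochner_Integration.integral_sum L2_integrable_inner assms)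

lemma L2_inner_self: "L2_inner \<Omega> u u = (LINT x|lebesgue_on \<Omega>. (norm (u x))\<^sup>2)"
  by (simp add: L2_inner_def power2_norm_eq_inner)

lemma L2_inner_self_nonneg: "0 \<le> L2_inner \<Omega> u u"
  by (simp add: L2_inner_self)

lemma L2_norm_nonneg: "0 \<le> L2_norm \<Omega> u"
  by (simp add: L2_norm_def L2_inner_self_nonneg)

lemma L2_norm_square: "(L2_norm \<Omega> u)\<^sup>2 = L2_inner \<Omega> u u"
  by (simp add: L2_norm_def L2_inner_self_nonneg)

lemma L2_norm_minus_commute: "L2_norm \<Omega> (\<lambda>x. u x - v x) = L2_norm \<Omega> (\<lambda>x. v x - u x)"
  by (simp add: L2_norm_def L2_inner_self norm_minus_commute)

lemma L2_norm_norm: "L2_norm \<Omega> (\<lambda>x. norm (u x)) = L2_norm \<Omega> u"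
  by (simp add: L2_norm_def L2_inner_self)

text \<open>The squared norm of \<open>u - t v\<close> is a quadratic in \<open>t\<close> that is
  never negative. Functions stand for their classes here, so \<open>L2_inner\<close> is only
  semidefinite and a \<open>v\<close> of norm 0 is treated apart.\<close>

lemma L2_Cauchy_Schwarz:
  assumes u: "u \<in> L2 \<Omega>" and v: "v \<in> L2 \<Omega>"
  shows "\<bar>L2_inner \<Omega> u v\<bar> \<le> L2_norm \<Omega> u * L2_norm \<Omega> v"
proof -
  let ?p = "L2_inner \<Omega> u v" and ?U = "L2_inner \<Omega> u u" and ?V = "L2_inner \<Omega> v v"
  have quad: "0 \<le> ?U - 2 * t * ?p + t\<^sup>2 * ?V" for t
  proof -
    have tv: "(\<lambda>x. t *\<^sub>R v x) \<in> L2 \<Omega>" using v by (rule L2_scaleR)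
    have "0 \<le> L2_inner \<Omega> (\<lambda>x. u x - t *\<^sub>R v x) (\<lambda>x. u x - t *\<^sub>R v x)"
      by (rule L2_inner_self_nonneg)
    also have "\<dots> = ?U - 2 * t * ?p + t\<^sup>2 * ?V"
      using u v tv
      by (simp add: L2_inner_diff_left L2_inner_diff_right L2_diff L2_inner_scaleR_left
          L2_inner_commute[of \<Omega> _ "\<lambda>x. t *\<^sub>R v x"] L2_inner_commute[of \<Omega> v u]
          algebra_simps power2_eq_square)
    finally show ?thesis .
  qed
  have "?p\<^sup>2 \<le> ?U * ?V"
  proof (cases "?V = 0")
    case True
    have "?p = 0"
    proof (rule ccontr)
      assume "?p \<noteq> 0"
      then show False
        \<comment> \<open>With \<open>?V = 0\<close> the quadratic is affine in \<open>t\<close>,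
          and this \<open>t\<close> gives it the value \<open>-1\<close>.\<close>
        using quad[of "(?U + 1) / (2 * ?p)"] True by simp
    qed
    then show ?thesis using True by simp
  next
    case False
    then have "0 < ?V" using L2_inner_self_nonneg[of \<Omega> v] by simp
    then show ?thesis
      \<comment> \<open>The minimiser of the quadratic.\<close>
      using quad[of "?p / ?V"] by (simp add: field_simps power2_eq_square)
  qed
  then have "\<bar>?p\<bar> \<le> sqrt (?U * ?V)"
    by (rule real_le_rsqrt[of "\<bar>?p\<bar>", simplified])
  then show ?thesis
    by (simp add: L2_norm_def real_sqrt_mult)
qed

text \<open>Continuity of the inner product. It carries identities for test functions or partial
  sums over to the limit, in the Poincare inequality as well as for coefficients and
  Parseval.\<close>

lemma L2_inner_tendsto:
  assumes w: "w \<in> L2 \<Omega>" and g: "\<And>n. g n \<in> L2 \<Omega>" and u: "u \<in> L2 \<Omega>"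
    and lim: "(\<lambda>n. L2_norm \<Omega> (\<lambda>x. g n x - u x)) \<longlonglongrightarrow> 0"
  shows "(\<lambda>n. L2_inner \<Omega> w (g n)) \<longlonglongrightarrow> L2_inner \<Omega> w u"
proof (rule LIM_zero_cancel, rule Lim_null_comparison)
  show "\<forall>\<^sub>F n in sequentially. norm (L2_inner \<Omega> w (g n) - L2_inner \<Omega> w u)
      \<le> L2_norm \<Omega> w * L2_norm \<Omega> (\<lambda>x. g n x - u x)"
    using L2_Cauchy_Schwarz[OF w L2_diff[OF g u]] by (simp add: L2_inner_diff_right g u w)
  show "(\<lambda>n. L2_norm \<Omega> w * L2_norm \<Omega> (\<lambda>x. g n x - u x)) \<longlonglongrightarrow> 0"
    by (rule tendsto_mult_right_zero[OF lim])
qed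

lemma L2_const:
  assumes "\<Omega> \<in> lmeasurable"
  shows "(\<lambda>x. c) \<in> L2 \<Omega>"
proof -
  interpret finite_measure "lebesgue_on \<Omega>"
    using assms by (rule finite_measure_lebesgue_on)
  show ?thesis by (simp add: L2_def)
qed

lemma L2_norm_in_L2: "u \<in> L2 \<Omega> \<Longrightarrow> (\<lambda>x. norm (u x)) \<in> L2 \<Omega>"
  by (auto simp: L2_def)

lemma L2_integrable:
  assumes "\<Omega> \<in> lmeasurable" "u \<in> L2 \<Omega>"
  shows "integrable (lebesgue_on \<Omega>) u"
proof -
  have "integrable (lebesgue_on \<Omega>) (\<lambda>x. norm (u x))"
    using L2_integrable_inner[OF L2_norm_in_L2[OF assms(2)] L2_const[OF assms(1), of 1]] by simp
  then show ?thesis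
    using L2_measurable[OF assms(2)] by (simp add: integrable_norm_iff)
qed

text \<open>Cauchy-Schwarz against the constant 1, which lies in \<open>L2 \<Omega>\<close> because
  the measure is finite.\<close>

lemma L1_le_L2_norm:
  assumes "\<Omega> \<in> lmeasurable" "u \<in> L2 \<Omega>"
  shows "(LINT x|lebesgue_on \<Omega>. norm (u x)) \<le> L2_norm \<Omega> u * L2_norm \<Omega> (\<lambda>x. 1::real)"
  using L2_Cauchy_Schwarz[OF L2_norm_in_L2[OF assms(2)] L2_const[OF assms(1), of 1]]
  by (simp add: L2_norm_norm) (simp add: L2_inner_def)

text \<open>On a set of finite measure a Cauchy sequence in \<open>L2\<close> is Cauchy in
  \<open>L1\<close>, so a subsequence converges almost everywhere. Fatou's lemma then transfers the
  Cauchy estimate to the distance from the pointwise limit.\<close>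

lemma L2_complete:
  fixes g :: "nat \<Rightarrow> 'a::euclidean_space \<Rightarrow> 'b::euclidean_space"
  assumes \<Omega>: "\<Omega> \<in> lmeasurable" and g: "\<And>n. g n \<in> L2 \<Omega>"
    and cauchy: "\<And>\<epsilon>. 0 < \<epsilon> \<Longrightarrow> \<exists>N. \<forall>m\<ge>N. \<forall>n\<ge>N. L2_norm \<Omega> (\<lambda>x. g m x - g n x) < \<epsilon>"
  shows "\<exists>u\<in>L2 \<Omega>. (\<lambda>n. L2_norm \<Omega> (\<lambda>x. g n x - u x)) \<longlonglongrightarrow> 0"
proof -
  note [measurable] = L2_measurable[OF g]
  have "\<exists>N. \<forall>i\<ge>N. \<forall>j\<ge>N. (LINT x|lebesgue_on \<Omega>. norm (g i x - g j x)) < \<epsilon>"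
    if \<epsilon>: "0 < \<epsilon>" for \<epsilon>
  proof -
    \<comment> \<open>The summand 1 keeps the divisor positive even if \<open>\<Omega>\<close> is
      null.\<close>
    let ?K = "L2_norm \<Omega> (\<lambda>x. 1::real) + 1"
    have K: "0 < ?K" using L2_norm_nonneg[of \<Omega> "\<lambda>x. 1::real"] by simp
    then obtain N where N: "\<And>m n. m \<ge> N \<Longrightarrow> n \<ge> N \<Longrightarrow> L2_norm \<Omega> (\<lambda>x. g m x - g n x) < \<epsilon> / ?K"
      using cauchy[of "\<epsilon> / ?K"] \<epsilon> by (meson divide_pos_pos)
    have "(LINT x|lebesgue_on \<Omega>. norm (g i x - g j x)) < \<epsilon>" if "i \<ge> N" "j \<ge> N" for i j
    proof -
      have "(LINT x|lebesgue_on \<Omega>. norm (g i x - g j x))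
          \<le> L2_norm \<Omega> (\<lambda>x. g i x - g j x) * L2_norm \<Omega> (\<lambda>x. 1::real)"
        by (rule L1_le_L2_norm[OF \<Omega> L2_diff[OF g g]])
      also have "\<dots> \<le> L2_norm \<Omega> (\<lambda>x. g i x - g j x) * ?K"
        by (intro mult_left_mono) (auto simp: L2_norm_nonneg)
      also have "\<dots> < \<epsilon>"
        using N[OF that] K by (simp add: pos_less_divide_eq)
      finally show ?thesis .
    qed
    then show ?thesis by blast
  qed
  then obtain r where r: "strict_mono r" and
    ae: "AE x in lebesgue_on \<Omega>. Cauchy (\<lambda>i. g (r i) x)"
    using cauchy_L1_AE_cauchy_subseq[of "lebesgue_on \<Omega>" g] L2_integrable[OF \<Omega> g] by blast
  \<comment> \<open>On the null set where the subsequence is not Cauchy, the value of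
    \<open>lim\<close> has no significance; \<open>u\<close> is measurable all the same.\<close>
  define u where "u x = lim (\<lambda>i. g (r i) x)" for x
  have um [measurable]: "u \<in> borel_measurable (lebesgue_on \<Omega>)"
    unfolding u_def by measurable
  have u_lim: "AE x in lebesgue_on \<Omega>. (\<lambda>i. g (r i) x) \<longlonglongrightarrow> u x"
    using ae by eventually_elim (simp add: u_def Cauchy_convergent_iff convergent_LIMSEQ_iff)
  \<comment> \<open>Membership in \<open>L2\<close> is proved together with the estimate, since
    \<open>u\<close> itself is not yet known to be square integrable: the finite bound from Fatou's
    lemma yields both.\<close>
  have bound: "\<exists>N. \<forall>n\<ge>N. (\<lambda>x. g n x - u x) \<in> L2 \<Omega> \<and> L2_norm \<Omega> (\<lambda>x. g n x - u x) \<le> \<epsilon>"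
    if \<epsilon>: "0 < \<epsilon>" for \<epsilon>
  proof -
    obtain N where N: "\<And>m n. m \<ge> N \<Longrightarrow> n \<ge> N \<Longrightarrow> L2_norm \<Omega> (\<lambda>x. g m x - g n x) < \<epsilon>"
      using cauchy[OF \<epsilon>] by blast
    have "(\<lambda>x. g n x - u x) \<in> L2 \<Omega> \<and> L2_norm \<Omega> (\<lambda>x. g n x - u x) \<le> \<epsilon>" if n: "n \<ge> N" for n
    proof -
      have "(\<integral>\<^sup>+x. ennreal ((norm (g n x - u x))\<^sup>2) \<partial>lebesgue_on \<Omega>)
          \<le> (\<integral>\<^sup>+x. liminf (\<lambda>i. ennreal ((norm (g n x - g (r i) x))\<^sup>2)) \<partial>lebesgue_on \<Omega>)"
      proof (rule nn_integral_mono_AE)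
        show "AE x in lebesgue_on \<Omega>. ennreal ((norm (g n x - u x))\<^sup>2)
            \<le> liminf (\<lambda>i. ennreal ((norm (g n x - g (r i) x))\<^sup>2))"
          using u_lim
        proof eventually_elim
          case (elim x)
          have "(\<lambda>i. ennreal ((norm (g n x - g (r i) x))\<^sup>2)) \<longlonglongrightarrow> ennreal ((norm (g n x - u x))\<^sup>2)"
            by (intro tendsto_ennrealI tendsto_intros elim)
          from lim_imp_Liminf[OF sequentially_bot this] show ?case
            by (metis order_refl)
        qed
      qed
      also have "\<dots> \<le> liminf (\<lambda>i. \<integral>\<^sup>+x. ennreal ((norm (g n x - g (r i) x))\<^sup>2) \<partial>lebesgue_on \<Omega>)"
        by (rule nn_integral_liminf) measurable
      also have "\<dots> \<le> ennreal (\<epsilon>\<^sup>2)"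
      proof (rule Liminf_le)
        have "\<forall>\<^sub>F i in sequentially. i \<ge> N" by (rule eventually_ge_at_top)
        then show "\<forall>\<^sub>F i in sequentially.
            (\<integral>\<^sup>+x. ennreal ((norm (g n x - g (r i) x))\<^sup>2) \<partial>lebesgue_on \<Omega>) \<le> ennreal (\<epsilon>\<^sup>2)"
        proof eventually_elim
          case (elim i)
          \<comment> \<open>A strictly increasing \<open>r\<close> satisfies
            \<open>i \<le> r i\<close>, so the Cauchy estimate covers the subsequence too.\<close>
          then have "r i \<ge> N" using seq_suble[OF r, of i] by linarith
          have "(\<integral>\<^sup>+x. ennreal ((norm (g n x - g (r i) x))\<^sup>2) \<partial>lebesgue_on \<Omega>)
              = ennreal ((L2_norm \<Omega> (\<lambda>x. g n x - g (r i) x))\<^sup>2)"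
            unfolding L2_norm_square L2_inner_self
            using g by (intro nn_integral_eq_integral L2_integrable_norm_square L2_diff) auto
          also have "\<dots> \<le> ennreal (\<epsilon>\<^sup>2)"
            using N[OF n \<open>r i \<ge> N\<close>] by (intro ennreal_leI power_mono) (auto simp: L2_norm_nonneg)
          finally show ?case .
        qed
      qed simp
      finally have le: "(\<integral>\<^sup>+x. ennreal ((norm (g n x - u x))\<^sup>2) \<partial>lebesgue_on \<Omega>) \<le> ennreal (\<epsilon>\<^sup>2)" .
      have "(\<integral>\<^sup>+x. ennreal ((norm (g n x - u x))\<^sup>2) \<partial>lebesgue_on \<Omega>) < \<infinity>"
        by (rule le_less_trans[OF le]) simp
      then have int: "integrable (lebesgue_on \<Omega>) (\<lambda>x. (norm (g n x - u x))\<^sup>2)"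
        by (intro integrableI_bounded) simp_all
      have "ennreal ((L2_norm \<Omega> (\<lambda>x. g n x - u x))\<^sup>2)
          = (\<integral>\<^sup>+x. ennreal ((norm (g n x - u x))\<^sup>2) \<partial>lebesgue_on \<Omega>)"
        unfolding L2_norm_square L2_inner_self
        by (rule nn_integral_eq_integral[OF int, symmetric]) simp
      also note le
      finally have "(L2_norm \<Omega> (\<lambda>x. g n x - u x))\<^sup>2 \<le> \<epsilon>\<^sup>2"
        by simp
      then have "L2_norm \<Omega> (\<lambda>x. g n x - u x) \<le> \<epsilon>"
        by (rule power2_le_imp_le) (use \<epsilon> in simp)
      then show ?thesis using int by (simp add: L2_def)
    qed
    then show ?thesis by blast
  qed
  obtain n where n: "(\<lambda>x. g n x - u x) \<in> L2 \<Omega>"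
    using bound[of 1] by auto
  have "u \<in> L2 \<Omega>"
    \<comment> \<open>Here \<open>u\<close> is written as \<open>g n - (g n - u)\<close>.\<close>
    using L2_diff[OF g[of n] n] by simp
  moreover have "(\<lambda>n. L2_norm \<Omega> (\<lambda>x. g n x - u x)) \<longlonglongrightarrow> 0"
  proof (rule LIMSEQ_I)
    fix \<epsilon> :: real assume "0 < \<epsilon>"
    then obtain N where "\<forall>n\<ge>N. L2_norm \<Omega> (\<lambda>x. g n x - u x) \<le> \<epsilon> / 2"
      using bound[of "\<epsilon> / 2"] by auto
    then show "\<exists>N. \<forall>n\<ge>N. norm (L2_norm \<Omega> (\<lambda>x. g n x - u x) - 0) < \<epsilon>"
      using \<open>0 < \<epsilon>\<close> by (intro exI[of _ N]) (force simp: L2_norm_nonneg)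
  qed
  ultimately show ?thesis by blast
qed

subsection \<open>Poincare inequality and the lower bound of the spectrum\<close>

text \<open>The product rule for a coordinate times \<open>u\<close> leaves one term in which
  \<open>u\<close> is not differentiated; its regularity at the lower order comes from here.\<close>

lemma Ck_Suc_D: "Ck (Suc k) u \<Longrightarrow> Ck k u"
proof (induction k arbitrary: u)
  case 0
  then show ?case
    by (auto intro!: differentiable_imp_continuous_on simp: differentiable_on_def)
next
  case (Suc k)
  then show ?case
    \<comment> \<open>Only these instances are unfolded, so that the derivatives keep the form
      \<open>Ck (Suc k)\<close> that the induction hypothesis expects.\<close>
    unfolding Ck.simps(2)[of "Suc k"] Ck.simps(2)[of k u] by blast
qed

lemma Ck_add: "Ck k u \<Longrightarrow> Ck k v \<Longrightarrow> Ck k (\<lambda>x. u x + v x)"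
proof (induction k arbitrary: u v)
  case 0
  then show ?case by (auto intro: continuous_intros)
next
  case (Suc k)
  have "frechet_derivative (\<lambda>x. u x + v x) (at x) =
      (\<lambda>h. frechet_derivative u (at x) h + frechet_derivative v (at x) h)" for x
    using Suc.prems by (intro frechet_derivative_at[symmetric] has_derivative_add)
      (auto simp: frechet_derivative_works[symmetric])
  then show ?case using Suc by auto
qed

lemma Ck_cmult: "Ck k u \<Longrightarrow> Ck k (\<lambda>x. c * u x)"
proof (induction k arbitrary: u)
  case 0
  then show ?case by (auto intro: continuous_intros)
next
  case (Suc k)
  have "frechet_derivative (\<lambda>x. c * u x) (at x) = (\<lambda>h. c * frechet_derivative u (at x) h)" for x
    using Suc.prems by (intro frechet_derivative_at[symmetric] has_derivative_mult_right)
      (auto simp: frechet_derivative_works[symmetric])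
  then show ?case using Suc by auto
qed

lemma has_derivative_inner_times:
  assumes "u differentiable (at x)"
  shows "((\<lambda>x. (x \<bullet> i) * u x) has_derivative
    (\<lambda>h. (x \<bullet> i) * frechet_derivative u (at x) h + (h \<bullet> i) * u x)) (at x)"
  using assms by (intro has_derivative_mult has_derivative_inner_left has_derivative_ident)
    (auto simp: frechet_derivative_works[symmetric])

lemma Ck_inner_times: "Ck k u \<Longrightarrow> Ck k (\<lambda>x. (x \<bullet> i) * u x)"
proof (induction k arbitrary: u)
  case 0
  then show ?case by (auto intro!: continuous_intros)
next
  case (Suc k)
  have "frechet_derivative (\<lambda>x. (x \<bullet> i) * u x) (at x) =
      (\<lambda>h. (x \<bullet> i) * frechet_derivative u (at x) h + (h \<bullet> i) * u x)" for x
    using Suc.prems by (intro frechet_derivative_at[symmetric] has_derivative_inner_times) auto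
  moreover have "(\<lambda>x. (x \<bullet> i) * u x) differentiable (at x)" for x
    using has_derivative_inner_times[of u x i] Suc.prems by (auto simp: differentiable_def)
  ultimately show ?case
    using Suc Ck_Suc_D[OF Suc.prems] by (auto intro!: Ck_add Ck_cmult)
qed

text \<open>Multiplication by a coordinate cannot enlarge the support, and a closed subset of a
  compact set is compact. This makes the product a legitimate test function for the weak
  gradient.\<close>

lemma test_functions_inner_times:
  assumes "\<psi> \<in> test_functions \<Omega>"
  shows "(\<lambda>x. (x \<bullet> i) * \<psi> x) \<in> test_functions \<Omega>"
proof -
  have sub: "closure {x. (x \<bullet> i) * \<psi> x \<noteq> 0} \<subseteq> closure {x. \<psi> x \<noteq> 0}"
    by (rule closure_mono) auto
  have "compact (closure {x. \<psi> x \<noteq> 0} \<inter> closure {x. (x \<bullet> i) * \<psi> x \<noteq> 0})"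
    using assms by (intro compact_Int_closed) (auto simp: test_functions_def)
  then have "compact (closure {x. (x \<bullet> i) * \<psi> x \<noteq> 0})"
    using sub by (simp add: inf.absorb2)
  then show ?thesis
    using assms sub by (auto simp: test_functions_def Ck_inner_times)
qed

lemma grad_inner_times:
  assumes "u differentiable (at x)" "i \<in> Basis"
  shows "grad (\<lambda>x. (x \<bullet> i) * u x) x \<bullet> i = (x \<bullet> i) * (grad u x \<bullet> i) + u x"
proof -
  have "frechet_derivative (\<lambda>x. (x \<bullet> i) * u x) (at x) =
      (\<lambda>h. (x \<bullet> i) * frechet_derivative u (at x) h + (h \<bullet> i) * u x)"
    using assms by (intro frechet_derivative_at[symmetric] has_derivative_inner_times)
  then show ?thesis
    using assms by (simp add: grad_def inner_sum_left_Basis)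
qed

text \<open>A function continuous on the whole space is bounded on the compact closure of
  \<open>\<Omega>\<close>, and \<open>\<Omega>\<close> has finite measure.\<close>

lemma L2_continuous:
  fixes u :: "'a::euclidean_space \<Rightarrow> 'b::euclidean_space"
  assumes \<Omega>: "open \<Omega>" "bounded \<Omega>" and u: "continuous_on UNIV u"
  shows "u \<in> L2 \<Omega>"
proof -
  interpret finite_measure "lebesgue_on \<Omega>"
    by (intro finite_measure_lebesgue_on lmeasurable_open \<Omega>)
  have "compact (u ` closure \<Omega>)"
    using \<Omega>(2) by (intro compact_continuous_image continuous_on_subset[OF u]) auto
  then obtain B where "\<forall>y\<in>u ` closure \<Omega>. norm y \<le> B"
    using compact_imp_bounded bounded_iff by blast
  then have B: "\<And>x. x \<in> \<Omega> \<Longrightarrow> norm (u x) \<le> B"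
    using closure_subset[of \<Omega>] by blast
  have meas [measurable]: "u \<in> borel_measurable (lebesgue_on \<Omega>)"
    using \<Omega>(1) by (intro continuous_imp_measurable_on_sets_lebesgue continuous_on_subset[OF u]) auto
  have "integrable (lebesgue_on \<Omega>) (\<lambda>x. (norm (u x))\<^sup>2)"
    by (rule integrable_const_bound[where B = "B\<^sup>2"]) (auto intro!: AE_I2 power_mono B)
  with meas show ?thesis by (simp add: L2_def)
qed

text \<open>Applied below with a coordinate function as \<open>m\<close>, which the radius of a ball
  containing \<open>\<Omega>\<close> bounds.\<close>

lemma L2_bounded_scaleR:
  fixes u :: "'a::euclidean_space \<Rightarrow> 'b::euclidean_space"
  assumes m: "m \<in> borel_measurable (lebesgue_on \<Omega>)" and B: "\<And>x. x \<in> \<Omega> \<Longrightarrow> \<bar>m x\<bar> \<le> B"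
    and u: "u \<in> L2 \<Omega>"
  shows "(\<lambda>x. m x *\<^sub>R u x) \<in> L2 \<Omega>"
    and "L2_inner \<Omega> (\<lambda>x. m x *\<^sub>R u x) (\<lambda>x. m x *\<^sub>R u x) \<le> B\<^sup>2 * L2_inner \<Omega> u u"
proof -
  have le: "(norm (m x *\<^sub>R u x))\<^sup>2 \<le> B\<^sup>2 * (norm (u x))\<^sup>2" if "x \<in> \<Omega>" for x
    using B[OF that] by (auto simp: power_mult_distrib intro!: mult_right_mono abs_le_square_iff[THEN iffD1])
  have int: "integrable (lebesgue_on \<Omega>) (\<lambda>x. B\<^sup>2 * (norm (u x))\<^sup>2)"
    using L2_integrable_norm_square[OF u] by simp
  have meas: "(\<lambda>x. m x *\<^sub>R u x) \<in> borel_measurable (lebesgue_on \<Omega>)"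
    using m L2_measurable[OF u] by measurable
  have int': "integrable (lebesgue_on \<Omega>) (\<lambda>x. (norm (m x *\<^sub>R u x))\<^sup>2)"
  proof (rule Bochner_Integration.integrable_bound[OF int])
    show "(\<lambda>x. (norm (m x *\<^sub>R u x))\<^sup>2) \<in> borel_measurable (lebesgue_on \<Omega>)"
      using meas by measurable
  qed (use le in \<open>auto intro!: AE_I2\<close>)
  then show "(\<lambda>x. m x *\<^sub>R u x) \<in> L2 \<Omega>"
    using meas by (auto simp: L2_def)
  have "L2_inner \<Omega> (\<lambda>x. m x *\<^sub>R u x) (\<lambda>x. m x *\<^sub>R u x)
      \<le> (LINT x|lebesgue_on \<Omega>. B\<^sup>2 * (norm (u x))\<^sup>2)"
    unfolding L2_inner_self by (rule integral_mono[OF int' int]) (use le in auto)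
  then show "L2_inner \<Omega> (\<lambda>x. m x *\<^sub>R u x) (\<lambda>x. m x *\<^sub>R u x) \<le> B\<^sup>2 * L2_inner \<Omega> u u"
    by (simp add: L2_inner_self)
qed

lemma test_functions_L2:
  assumes "open \<Omega>" "bounded \<Omega>" "\<psi> \<in> test_functions \<Omega>"
  shows "\<psi> \<in> L2 \<Omega>" and "grad \<psi> \<in> L2 \<Omega>"
proof -
  have "Ck 0 \<psi>" and "Ck (Suc 0) \<psi>"
    using assms(3) unfolding test_functions_def by blast+
  then show "\<psi> \<in> L2 \<Omega>" and "grad \<psi> \<in> L2 \<Omega>"
    unfolding grad_def[abs_def] by (auto intro!: L2_continuous assms continuous_intros)
qed

text \<open>Since \<open>\<partial>\<^sub>i (x\<^sub>i u) = u + x\<^sub>i \<partial>\<^sub>i u\<close>, testing the weak gradient of \<open>u\<close> with \<open>x\<^sub>i \<psi>\<^sub>n\<close>, where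
  \<open>\<psi>\<^sub>n\<close> tends to \<open>u\<close>, gives \<open>\<parallel>u\<parallel>\<^sup>2 = - 2 \<integral> x\<^sub>i u \<partial>\<^sub>i u\<close>.\<close>

lemma weak_Poincare:
  fixes \<Omega> :: "'a::euclidean_space set"
  assumes \<Omega>: "open \<Omega>" "bounded \<Omega>" and R: "\<And>x. x \<in> \<Omega> \<Longrightarrow> norm x \<le> R" and u: "u \<in> H10 \<Omega>"
  shows "\<exists>G. weak_gradient \<Omega> u G \<and> L2_inner \<Omega> u u \<le> 4 * R\<^sup>2 * L2_inner \<Omega> G G"
proof -
  obtain G \<psi> where G: "weak_gradient \<Omega> u G" and \<psi>: "\<And>n::nat. \<psi> n \<in> test_functions \<Omega>"
    and lim: "(\<lambda>n. L2_norm \<Omega> (\<lambda>x. \<psi> n x - u x)) \<longlonglongrightarrow> 0"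
    and lim_grad: "(\<lambda>n. L2_norm \<Omega> (\<lambda>x. grad (\<psi> n) x - G x)) \<longlonglongrightarrow> 0"
    using u unfolding H10_def by blast
  have uL2: "u \<in> L2 \<Omega>" and GL2: "G \<in> L2 \<Omega>"
    using G by (auto simp: weak_gradient_def)
  note \<psi>L2 = test_functions_L2[OF \<Omega> \<psi>]
  obtain i :: 'a where i: "i \<in> Basis" using nonempty_Basis by blast
  have coord_meas: "(\<lambda>x. x \<bullet> i) \<in> borel_measurable (lebesgue_on \<Omega>)"
    using \<Omega>(1) by (intro continuous_imp_measurable_on_sets_lebesgue continuous_intros) auto
  have coord_le: "\<bar>x \<bullet> i\<bar> \<le> R" if "x \<in> \<Omega>" for x
    using Basis_le_norm[OF i, of x] R[OF that] by linarith
  \<comment> \<open>The vector field with \<open>i\<close>-th component \<open>x_i u\<close> and no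
    other turns the integral of \<open>x_i u\<close> times a partial derivative into an inner
    product with the full gradient.\<close>
  define xu where "xu = (\<lambda>x. ((x \<bullet> i) * u x) *\<^sub>R i)"
  have xu_eq: "xu = (\<lambda>x. (x \<bullet> i) *\<^sub>R (u x *\<^sub>R i))"
    by (simp add: xu_def)
  have ui: "(\<lambda>x. u x *\<^sub>R i) \<in> L2 \<Omega>"
    using uL2 i by (auto simp: L2_def)
  have xuL2: "xu \<in> L2 \<Omega>"
    unfolding xu_eq by (rule L2_bounded_scaleR(1)[OF coord_meas coord_le ui])
  have xu_le: "L2_inner \<Omega> xu xu \<le> R\<^sup>2 * L2_inner \<Omega> u u"
    using L2_bounded_scaleR(2)[OF coord_meas coord_le ui] i
    unfolding xu_eq by (simp add: L2_inner_self)
  have Gi: "(\<lambda>x. G x \<bullet> i) \<in> L2 \<Omega>"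
  proof -
    have "(\<lambda>x. G x \<bullet> i) \<in> borel_measurable (lebesgue_on \<Omega>)"
      using L2_measurable[OF GL2] by measurable
    moreover have "(norm (G x \<bullet> i))\<^sup>2 \<le> (norm (G x))\<^sup>2" for x
      using Basis_le_norm[OF i, of "G x"] by (simp add: abs_le_square_iff[symmetric])
    ultimately show ?thesis
      unfolding L2_def
      by (auto intro!: Bochner_Integration.integrable_bound[OF L2_integrable_norm_square[OF GL2]])
  qed
  have xGi: "(\<lambda>x. (x \<bullet> i) * (G x \<bullet> i)) \<in> L2 \<Omega>"
    using L2_bounded_scaleR(1)[OF coord_meas coord_le Gi] by simp
  have test: "L2_inner \<Omega> u (\<psi> n) + L2_inner \<Omega> xu (grad (\<psi> n))
      = - L2_inner \<Omega> (\<lambda>x. (x \<bullet> i) * (G x \<bullet> i)) (\<psi> n)" for n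
  proof -
    have diff: "\<psi> n differentiable (at x)" for x
    proof -
      have "Ck (Suc 0) (\<psi> n)"
        using \<psi>[of n] unfolding test_functions_def by blast
      then show ?thesis by simp
    qed
    have "(LINT x|lebesgue_on \<Omega>. u x * (grad (\<lambda>x. (x \<bullet> i) * \<psi> n x) x \<bullet> i))
        = - (LINT x|lebesgue_on \<Omega>. (G x \<bullet> i) * ((x \<bullet> i) * \<psi> n x))"
      using G test_functions_inner_times[OF \<psi>, of i n] i unfolding weak_gradient_def by blast
    moreover have "(\<lambda>x. u x * (grad (\<lambda>x. (x \<bullet> i) * \<psi> n x) x \<bullet> i))
        = (\<lambda>x. u x \<bullet> \<psi> n x + xu x \<bullet> grad (\<psi> n) x)"
      unfolding grad_inner_times[OF diff i]
      by (simp add: fun_eq_iff xu_def algebra_simps inner_commute)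
    ultimately show ?thesis
      using Bochner_Integration.integral_add[OF L2_integrable_inner[OF uL2 \<psi>L2(1)]
          L2_integrable_inner[OF xuL2 \<psi>L2(2)], of n n]
      by (simp add: L2_inner_def mult_ac)
  qed
  \<comment> \<open>Both sides of \<open>test\<close> are followed to the limit, using the
    convergence of the test functions and of their gradients.\<close>
  have "L2_inner \<Omega> u u + L2_inner \<Omega> xu G = - L2_inner \<Omega> (\<lambda>x. (x \<bullet> i) * (G x \<bullet> i)) u"
  proof (rule LIMSEQ_unique)
    show "(\<lambda>n. L2_inner \<Omega> u (\<psi> n) + L2_inner \<Omega> xu (grad (\<psi> n)))
        \<longlonglongrightarrow> L2_inner \<Omega> u u + L2_inner \<Omega> xu G"
      by (intro tendsto_add L2_inner_tendsto uL2 xuL2 \<psi>L2 GL2 lim lim_grad)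
    show "(\<lambda>n. L2_inner \<Omega> u (\<psi> n) + L2_inner \<Omega> xu (grad (\<psi> n)))
        \<longlonglongrightarrow> - L2_inner \<Omega> (\<lambda>x. (x \<bullet> i) * (G x \<bullet> i)) u"
      unfolding test by (intro tendsto_minus L2_inner_tendsto xGi \<psi>L2 uL2 lim)
  qed
  moreover have "L2_inner \<Omega> (\<lambda>x. (x \<bullet> i) * (G x \<bullet> i)) u = L2_inner \<Omega> xu G"
    by (simp add: L2_inner_def xu_def inner_commute mult_ac)
  ultimately have "L2_inner \<Omega> u u \<le> 2 * \<bar>L2_inner \<Omega> xu G\<bar>"
    by linarith
  also have "\<dots> \<le> 2 * (L2_norm \<Omega> xu * L2_norm \<Omega> G)"
    using L2_Cauchy_Schwarz[OF xuL2 GL2] by simp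
  \<comment> \<open>Squaring brings in the squared norm of \<open>xu\<close>, which
    \<open>xu_le\<close> bounds by a multiple of that of \<open>u\<close>. One factor
    \<open>L2_inner \<Omega> u u\<close> can then be cancelled unless it is 0, and in that case the
    claim is clear.\<close>
  finally have "(L2_inner \<Omega> u u)\<^sup>2 \<le> (2 * (L2_norm \<Omega> xu * L2_norm \<Omega> G))\<^sup>2"
    by (intro power_mono L2_inner_self_nonneg)
  also have "\<dots> = 4 * L2_inner \<Omega> G G * L2_inner \<Omega> xu xu"
    by (simp add: power_mult_distrib L2_norm_square)
  also have "\<dots> \<le> 4 * L2_inner \<Omega> G G * (R\<^sup>2 * L2_inner \<Omega> u u)"
    by (intro mult_left_mono xu_le) (simp add: L2_inner_self_nonneg)
  finally have "L2_inner \<Omega> u u * L2_inner \<Omega> u u \<le> (4 * R\<^sup>2 * L2_inner \<Omega> G G) * L2_inner \<Omega> u u"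
    by (simp add: power2_eq_square mult_ac)
  then have "L2_inner \<Omega> u u \<le> 4 * R\<^sup>2 * L2_inner \<Omega> G G"
    using L2_inner_self_nonneg[of \<Omega> u] L2_inner_self_nonneg[of \<Omega> G]
    by (cases "L2_inner \<Omega> u u = 0") auto
  with G show ?thesis by blast
qed

text \<open>Testing the eigenvalue equation with the normalised eigenfunction itself shows that
  \<open>lam k\<close> is the squared norm of its gradient, which the Poincare inequality bounds
  from below independently of \<open>k\<close>.\<close>

lemma dirichlet_eigenvalues_bounded_below:
  assumes \<Omega>: "open \<Omega>" "bounded \<Omega>" and basis: "dirichlet_eigenbasis \<Omega> lam e"
  obtains c where "0 < c" and "\<And>k. c \<le> lam k"
proof -
  obtain R where R: "0 < R" "\<And>x. x \<in> \<Omega> \<Longrightarrow> norm x \<le> R"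
    using \<Omega>(2) bounded_pos by blast
  have "1 / (4 * R\<^sup>2) \<le> lam k" for k
  proof -
    have "dirichlet_eigenpair \<Omega> (lam k) (e k)" and ee: "L2_inner \<Omega> (e k) (e k) = 1"
      using basis by (auto simp: dirichlet_eigenbasis_def L2_orthonormal_basis_def)
    then have e: "e k \<in> H10 \<Omega>"
      and eig: "\<And>G. weak_gradient \<Omega> (e k) G \<Longrightarrow>
        L2_inner \<Omega> G G = lam k * L2_inner \<Omega> (e k) (e k)"
      unfolding dirichlet_eigenpair_def by blast+
    obtain G where G: "weak_gradient \<Omega> (e k) G"
      "L2_inner \<Omega> (e k) (e k) \<le> 4 * R\<^sup>2 * L2_inner \<Omega> G G"
      using weak_Poincare[OF \<Omega> R(2) e] by blast
    show ?thesis
      using G(2) eig[OF G(1)] R(1) by (simp add: ee field_simps)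
  qed
  then show ?thesis using that[of "1 / (4 * R\<^sup>2)"] R(1) by simp
qed

subsection \<open>Expansions in an orthonormal basis\<close>

lemma L2_orthonormal_basisD:
  assumes "L2_orthonormal_basis \<Omega> e"
  shows "e k \<in> L2 \<Omega>" and "L2_inner \<Omega> (e j) (e k) = (if j = k then 1 else 0)"
    and "w \<in> L2 \<Omega> \<Longrightarrow> L2_sums \<Omega> (\<lambda>k. L2_inner \<Omega> w (e k)) e w"
  using assms by (auto simp: L2_orthonormal_basis_def)

lemma L2_lincomb:
  fixes e :: "nat \<Rightarrow> 'a::euclidean_space \<Rightarrow> real"
  shows "(\<And>k. e k \<in> L2 \<Omega>) \<Longrightarrow> (\<lambda>x. \<Sum>k\<in>A. c k * e k x) \<in> L2 \<Omega>"
  by (intro L2_sum L2_cmult)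

lemma L2_inner_lincomb_left:
  fixes e :: "nat \<Rightarrow> 'a::euclidean_space \<Rightarrow> real"
  assumes "\<And>k. e k \<in> L2 \<Omega>" "w \<in> L2 \<Omega>"
  shows "L2_inner \<Omega> (\<lambda>x. \<Sum>k\<in>A. c k * e k x) w = (\<Sum>k\<in>A. c k * L2_inner \<Omega> (e k) w)"
  using assms by (simp add: L2_inner_sum_left L2_cmult L2_inner_cmult_left)

lemma L2_inner_lincomb_basis:
  assumes e: "L2_orthonormal_basis \<Omega> e" and "finite A"
  shows "L2_inner \<Omega> (\<lambda>x. \<Sum>k\<in>A. c k * e k x) (e j) = (if j \<in> A then c j else 0)"
proof -
  have "L2_inner \<Omega> (\<lambda>x. \<Sum>k\<in>A. c k * e k x) (e j) = (\<Sum>k\<in>A. if k = j then c j else 0)"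
    unfolding L2_inner_lincomb_left[OF L2_orthonormal_basisD(1)[OF e] L2_orthonormal_basisD(1)[OF e]]
    by (rule sum.cong) (auto simp: L2_orthonormal_basisD(2)[OF e])
  then show ?thesis
    using assms(2) by simp
qed

lemma L2_inner_lincomb_self:
  assumes e: "L2_orthonormal_basis \<Omega> e" and "finite A"
  shows "L2_inner \<Omega> (\<lambda>x. \<Sum>k\<in>A. c k * e k x) (\<lambda>x. \<Sum>k\<in>A. c k * e k x) = (\<Sum>k\<in>A. (c k)\<^sup>2)"
proof -
  note eL2 = L2_orthonormal_basisD(1)[OF e]
  have "L2_inner \<Omega> (\<lambda>x. \<Sum>k\<in>A. c k * e k x) (\<lambda>x. \<Sum>k\<in>A. c k * e k x)
      = (\<Sum>j\<in>A. c j * L2_inner \<Omega> (e j) (\<lambda>x. \<Sum>k\<in>A. c k * e k x))"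
    by (intro L2_inner_lincomb_left L2_lincomb eL2)
  also have "\<dots> = (\<Sum>j\<in>A. (c j)\<^sup>2)"
    by (rule sum.cong)
      (auto simp: L2_inner_commute[of \<Omega> "e _"] L2_inner_lincomb_basis[OF assms] power2_eq_square)
  finally show ?thesis .
qed

text \<open>Pairing with \<open>e j\<close> is continuous, and orthonormality makes the pairing with
  the partial sums constant from some index on. The coefficients of an expansion are therefore
  unique.\<close>

lemma L2_sums_coefficients:
  assumes e: "L2_orthonormal_basis \<Omega> e" and w: "L2_sums \<Omega> c e w"
  shows "L2_inner \<Omega> w (e j) = c j"
proof (rule LIMSEQ_unique)
  note eL2 = L2_orthonormal_basisD(1)[OF e]
  show "(\<lambda>n. L2_inner \<Omega> (e j) (\<lambda>x. \<Sum>k<n. c k * e k x)) \<longlonglongrightarrow> L2_inner \<Omega> w (e j)"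
    unfolding L2_inner_commute[of \<Omega> w]
    using w by (intro L2_inner_tendsto) (auto simp: L2_sums_def intro: eL2 L2_lincomb)
  have "\<forall>\<^sub>F n in sequentially. c j = L2_inner \<Omega> (e j) (\<lambda>x. \<Sum>k<n. c k * e k x)"
    \<comment> \<open>The partial sum runs over \<open>k < n\<close>, so it contains
      \<open>e j\<close> exactly when \<open>n > j\<close>.\<close>
    using eventually_gt_at_top[of j]
    by eventually_elim (simp add: L2_inner_commute[of \<Omega> "e j"] L2_inner_lincomb_basis[OF e])
  then show "(\<lambda>n. L2_inner \<Omega> (e j) (\<lambda>x. \<Sum>k<n. c k * e k x)) \<longlonglongrightarrow> c j"
    by (rule Lim_transform_eventually[OF tendsto_const])
qed

text \<open>The expansion of \<open>w\<close> is paired with \<open>w\<close>; the partial sums of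
  the squares appear on the way to the limit.\<close>

lemma L2_Parseval:
  assumes e: "L2_orthonormal_basis \<Omega> e" and w: "w \<in> L2 \<Omega>"
  shows "(\<lambda>k. (L2_inner \<Omega> w (e k))\<^sup>2) sums L2_inner \<Omega> w w"
proof -
  note eL2 = L2_orthonormal_basisD(1)[OF e]
  let ?c = "\<lambda>k. L2_inner \<Omega> w (e k)"
  have "(\<lambda>n. L2_inner \<Omega> w (\<lambda>x. \<Sum>k<n. ?c k * e k x)) \<longlonglongrightarrow> L2_inner \<Omega> w w"
    using L2_orthonormal_basisD(3)[OF e w] w
    by (intro L2_inner_tendsto) (auto simp: L2_sums_def intro: eL2 L2_lincomb)
  moreover have "L2_inner \<Omega> w (\<lambda>x. \<Sum>k<n. ?c k * e k x) = (\<Sum>k<n. (?c k)\<^sup>2)" for n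
    unfolding L2_inner_commute[of \<Omega> w "\<lambda>x. \<Sum>k<n. ?c k * e k x"] L2_inner_lincomb_left[OF eL2 w]
    by (simp add: L2_inner_commute[of \<Omega> "e _" w] power2_eq_square)
  ultimately show ?thesis by (simp add: sums_def)
qed

text \<open>By orthonormality the squared distance of two partial sums is a block of the series of
  squares, so the partial sums are Cauchy and completeness applies.\<close>

lemma L2_Riesz_Fischer:
  assumes \<Omega>: "\<Omega> \<in> lmeasurable" and e: "L2_orthonormal_basis \<Omega> e"
    and c: "summable (\<lambda>k. (c k)\<^sup>2)"
  shows "\<exists>w. L2_sums \<Omega> c e w"
proof -
  define P where "P = (\<lambda>(n::nat) x. \<Sum>k<n. c k * e k x)"
  have PL2: "P n \<in> L2 \<Omega>" for n
    unfolding P_def by (intro L2_lincomb L2_orthonormal_basisD(1)[OF e])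
  have "\<exists>N. \<forall>m\<ge>N. \<forall>n\<ge>N. L2_norm \<Omega> (\<lambda>x. P m x - P n x) < \<epsilon>" if "0 < \<epsilon>" for \<epsilon>
  proof -
    obtain N where N: "\<And>m n. m \<ge> N \<Longrightarrow> norm (\<Sum>k=m..<n. (c k)\<^sup>2) < \<epsilon>\<^sup>2"
      using c[unfolded summable_Cauchy] \<open>0 < \<epsilon>\<close> by (meson zero_less_power)
    have *: "L2_norm \<Omega> (\<lambda>x. P m x - P n x) < \<epsilon>" if "N \<le> n" "n \<le> m" for m n
    proof -
      have "P m x - P n x = (\<Sum>k\<in>{n..<m}. c k * e k x)" for x
        using sum_diff_nat_ivl[of 0 n m "\<lambda>k. c k * e k x"] that by (simp add: P_def atLeast0LessThan)
      then have "(L2_norm \<Omega> (\<lambda>x. P m x - P n x))\<^sup>2 = (\<Sum>k=n..<m. (c k)\<^sup>2)"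
        by (simp add: L2_norm_square L2_inner_lincomb_self[OF e])
      also have "\<dots> < \<epsilon>\<^sup>2"
        using N[OF that(1), of m] by (simp add: sum_nonneg)
      finally show ?thesis
        by (rule power2_less_imp_less) (use \<open>0 < \<epsilon>\<close> in simp)
    qed
    show ?thesis
    proof (intro exI[of _ N] allI impI)
      fix m n assume "N \<le> m" "N \<le> n"
      then show "L2_norm \<Omega> (\<lambda>x. P m x - P n x) < \<epsilon>"
        using *[of n m] *[of m n] L2_norm_minus_commute[of \<Omega> "P m" "P n"]
        by (cases "n \<le> m") auto
    qed
  qed
  from L2_complete[OF \<Omega> PL2 this] show ?thesis
    by (auto simp: L2_sums_def P_def)
qed

subsection \<open>The control to state map\<close>

text \<open>For \<open>l \<ge> 1\<close> the worst exponent is \<open>s = 0\<close>, for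
  \<open>l < 1\<close> it is \<open>s = 1\<close>. The bound depends neither on \<open>s\<close> nor
  on the eigenvalue.\<close>

lemma powr_minus_le_max:
  fixes c l s :: real
  assumes "0 < c" "c \<le> l" "0 \<le> s" "s \<le> 1"
  shows "l powr (- s) \<le> max 1 (1 / c)"
proof (cases "1 \<le> l")
  case True
  then have "l powr (- s) \<le> l powr 0"
    using assms by (intro powr_mono) auto
  with True show ?thesis by simp
next
  case False
  have "l powr (- s) \<le> l powr (- 1)"
    using False assms by (intro powr_mono') auto
  also have "\<dots> = 1 / l"
    using assms by (simp add: powr_minus_divide)
  also have "\<dots> \<le> 1 / c"
    using assms by (simp add: frac_le)
  finally show ?thesis by simp
qed

text \<open>Near the ends \<open>F\<close> exceeds its value at the midpoint, so a minimum over a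
  compact interval containing the midpoint is global.\<close>

lemma continuous_coercive_attains_min:
  fixes F :: "real \<Rightarrow> real"
  assumes ab: "a < b" and cont: "continuous_on {a<..<b} F"
    and left: "filterlim F at_top (at_right a)" and right: "filterlim F at_top (at_left b)"
  shows "\<exists>x\<in>{a<..<b}. \<forall>y\<in>{a<..<b}. F x \<le> F y"
proof -
  let ?m = "(a + b) / 2"
  have "\<forall>\<^sub>F y in at_right a. F ?m \<le> F y" "\<forall>\<^sub>F y in at_left b. F ?m \<le> F y"
    using left right by (auto simp: filterlim_at_top)
  then obtain a' b' where a': "a < a'" "\<And>y. a < y \<Longrightarrow> y < a' \<Longrightarrow> F ?m \<le> F y"
    and b': "b' < b" "\<And>y. b' < y \<Longrightarrow> y < b \<Longrightarrow> F ?m \<le> F y"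
    by (auto simp: eventually_at_right_field eventually_at_left_field)
  \<comment> \<open>The cut-offs \<open>a'\<close> and \<open>b'\<close> may lie on the wrong side
    of the midpoint; \<open>min\<close> and \<open>max\<close> force \<open>?m\<close> into
    \<open>K\<close>.\<close>
  define K where "K = {min a' ?m..max b' ?m}"
  have "a < min a' ?m" "max b' ?m < b"
    using ab a'(1) b'(1) by simp_all
  then have K: "K \<subseteq> {a<..<b}"
    unfolding K_def by (intro subsetI) (auto simp del: min_less_iff_conj max_less_iff_conj)
  have m: "?m \<in> K"
    unfolding K_def by (simp only: atLeastAtMost_iff min.cobounded2 max.cobounded2)
  have "compact K" by (simp add: K_def)
  then obtain x where x: "x \<in> K" "\<forall>y\<in>K. F x \<le> F y"
    using continuous_attains_inf[of K F] continuous_on_subset[OF cont K] m by blast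
  have "F x \<le> F y" if "y \<in> {a<..<b}" for y
  proof (cases "y \<in> K")
    case False
    then have "F ?m \<le> F y"
      using that a'(2)[of y] b'(2)[of y] by (auto simp: K_def not_le)
    then show ?thesis
      using x(2) m by force
  qed (use x in blast)
  with x(1) K show ?thesis by blast
qed

section \<open>States for a spectrum bounded below by \<open>c > 0\<close>\<close>

context
  fixes \<Omega> :: "'a::euclidean_space set" and lam :: "nat \<Rightarrow> real" and e :: "nat \<Rightarrow> 'a \<Rightarrow> real"
    and c :: real and f :: "'a \<Rightarrow> real"
  assumes \<Omega>: "\<Omega> \<in> lmeasurable" and e: "L2_orthonormal_basis \<Omega> e"
    and c: "0 < c" and lam: "\<And>k. c \<le> lam k" and f: "f \<in> L2 \<Omega>"
begin

lemma lam_pos: "0 < lam k"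
  using c lam[of k] by linarith

text \<open>A majorant independent of \<open>s\<close>: it gives existence of the state and later
  uniform convergence of the tracking series.\<close>

lemma state_coefficient_square_le:
  assumes "0 \<le> s" "s \<le> 1"
  shows "(lam k powr (- s) * L2_inner \<Omega> f (e k))\<^sup>2 \<le> (max 1 (1 / c))\<^sup>2 * (L2_inner \<Omega> f (e k))\<^sup>2"
  unfolding power_mult_distrib
  using powr_minus_le_max[OF c lam assms] by (intro mult_right_mono power_mono) auto

text \<open>The Riesz-Fischer theorem supplies a witness, so the choice in
  \<open>control_to_state\<close> really picks a sum of the series.\<close>

lemma control_to_state_sums:
  assumes "0 \<le> s" "s \<le> 1"
  shows "L2_sums \<Omega> (\<lambda>k. lam k powr (- s) * L2_inner \<Omega> f (e k)) e (control_to_state \<Omega> lam e f s)"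
proof -
  have "summable (\<lambda>k. (lam k powr (- s) * L2_inner \<Omega> f (e k))\<^sup>2)"
    by (rule summable_comparison_test'[OF summable_mult[OF sums_summable[OF L2_Parseval[OF e f]]]])
      (use state_coefficient_square_le[OF assms] in auto)
  from someI_ex[OF L2_Riesz_Fischer[OF \<Omega> e this]] show ?thesis
    unfolding control_to_state_def .
qed

lemmas control_to_state_coefficient = L2_sums_coefficients[OF e control_to_state_sums]

lemma control_to_state_L2: "0 \<le> s \<Longrightarrow> s \<le> 1 \<Longrightarrow> control_to_state \<Omega> lam e f s \<in> L2 \<Omega>"
  using control_to_state_sums by (simp add: L2_sums_def)

text \<open>The weight \<open>lam k powr s\<close> meets the square of
  \<open>lam k powr (- s)\<close>, which leaves the bounded factor
  \<open>lam k powr (- s)\<close>.\<close>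

lemma control_to_state_Hs:
  assumes s: "0 \<le> s" "s \<le> 1"
  shows "control_to_state \<Omega> lam e f s \<in> Hs \<Omega> lam e s"
proof -
  let ?u = "control_to_state \<Omega> lam e f s"
  have "norm (lam k powr s * (L2_inner \<Omega> ?u (e k))\<^sup>2) \<le> max 1 (1 / c) * (L2_inner \<Omega> f (e k))\<^sup>2" for k
  proof -
    have "lam k powr s * (L2_inner \<Omega> ?u (e k))\<^sup>2 = lam k powr (- s) * (L2_inner \<Omega> f (e k))\<^sup>2"
      using lam_pos[of k]
      by (simp add: control_to_state_coefficient[OF s] powr_minus power2_eq_square field_simps)
    also have "\<dots> \<le> max 1 (1 / c) * (L2_inner \<Omega> f (e k))\<^sup>2"
      by (intro mult_right_mono powr_minus_le_max c lam s) simp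
    finally show ?thesis by simp
  qed
  then have "summable (\<lambda>k. lam k powr s * (L2_inner \<Omega> ?u (e k))\<^sup>2)"
    by (intro summable_comparison_test'[OF summable_mult[OF sums_summable[OF L2_Parseval[OF e f]]]])
      auto
  then show ?thesis
    unfolding Hs_def
    using control_to_state_L2[OF s] L2_orthonormal_basisD(3)[OF e control_to_state_L2[OF s]] by blast
qed

lemma control_to_state_solves:
  assumes s: "0 \<le> s" "s \<le> 1"
  shows "frac_laplacian \<Omega> lam e s (control_to_state \<Omega> lam e f s) f"
proof -
  have "lam k powr s * L2_inner \<Omega> (control_to_state \<Omega> lam e f s) (e k) = L2_inner \<Omega> f (e k)" for k
    using lam_pos[of k] by (simp add: control_to_state_coefficient[OF s] powr_minus)
  then show ?thesis
    using L2_orthonormal_basisD(3)[OF e f] control_to_state_Hs[OF s]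
    by (simp add: frac_laplacian_def)
qed

text \<open>Uniqueness for the state equation: every solution has the coefficients of the chosen
  state, so the cost of a solution depends on \<open>s\<close> alone.\<close>

lemma frac_laplacian_solution_coefficient:
  assumes "frac_laplacian \<Omega> lam e s v f"
  shows "L2_inner \<Omega> v (e k) = lam k powr (- s) * L2_inner \<Omega> f (e k)"
proof -
  have "L2_inner \<Omega> f (e k) = lam k powr s * L2_inner \<Omega> v (e k)"
    using assms by (intro L2_sums_coefficients[OF e]) (simp add: frac_laplacian_def)
  then show ?thesis
    using lam_pos[of k] by (simp add: powr_minus)
qed

lemma L2_distance_solution:
  assumes v: "v \<in> L2 \<Omega>" and ud: "ud \<in> L2 \<Omega>"
    and coeff: "\<And>k. L2_inner \<Omega> v (e k) = lam k powr (- s) * L2_inner \<Omega> f (e k)"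
  shows "(L2_norm \<Omega> (\<lambda>x. v x - ud x))\<^sup>2 =
    (\<Sum>k. (lam k powr (- s) * L2_inner \<Omega> f (e k) - L2_inner \<Omega> ud (e k))\<^sup>2)"
  using sums_unique[OF L2_Parseval[OF e L2_diff[OF v ud]]]
  by (simp add: L2_norm_square L2_inner_diff_left v ud L2_orthonormal_basisD(1)[OF e] coeff)

text \<open>Weierstrass M-test: each term is continuous in \<open>s\<close>, and the majorants are
  summable by Parseval for \<open>f\<close> and the assumption on \<open>d\<close>.\<close>

lemma continuous_on_tracking_series:
  assumes d: "summable (\<lambda>k. (d k)\<^sup>2)"
  shows "continuous_on {0..1} (\<lambda>s. \<Sum>k. (lam k powr (- s) * L2_inner \<Omega> f (e k) - d k)\<^sup>2)"
proof -
  have f2: "summable (\<lambda>k. (L2_inner \<Omega> f (e k))\<^sup>2)"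
    by (rule sums_summable[OF L2_Parseval[OF e f]])
  have "uniform_limit {0..1}
      (\<lambda>n s. \<Sum>k<n. (lam k powr (- s) * L2_inner \<Omega> f (e k) - d k)\<^sup>2)
      (\<lambda>s. \<Sum>k. (lam k powr (- s) * L2_inner \<Omega> f (e k) - d k)\<^sup>2) sequentially"
  proof (rule Weierstrass_m_test[where M =
        "\<lambda>k. 2 * ((max 1 (1 / c))\<^sup>2 * (L2_inner \<Omega> f (e k))\<^sup>2) + 2 * (d k)\<^sup>2"])
    fix k s assume s: "s \<in> {0..1::real}"
    have "(y - z)\<^sup>2 \<le> 2 * y\<^sup>2 + 2 * z\<^sup>2" for y z :: real
      using sum_squares_bound[of y "- z"] by (simp add: power2_diff)
    from this[of "lam k powr (- s) * L2_inner \<Omega> f (e k)" "d k"]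
    show "norm ((lam k powr (- s) * L2_inner \<Omega> f (e k) - d k)\<^sup>2)
        \<le> 2 * ((max 1 (1 / c))\<^sup>2 * (L2_inner \<Omega> f (e k))\<^sup>2) + 2 * (d k)\<^sup>2"
      using state_coefficient_square_le[of s k] s by simp
  next
    show "summable (\<lambda>k. 2 * ((max 1 (1 / c))\<^sup>2 * (L2_inner \<Omega> f (e k))\<^sup>2) + 2 * (d k)\<^sup>2)"
      by (intro summable_add summable_mult f2 d)
  qed
  moreover have "\<forall>\<^sub>F n in sequentially.
      continuous_on {0..1} (\<lambda>s. \<Sum>k<n. (lam k powr (- s) * L2_inner \<Omega> f (e k) - d k)\<^sup>2)"
    \<comment> \<open>Continuity of \<open>powr\<close> in the exponent uses that the base
      \<open>lam k\<close> is not 0.\<close>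
    using lam_pos by (intro always_eventually allI continuous_intros) (auto simp: less_imp_neq[symmetric])
  ultimately show ?thesis
    by (intro uniform_limit_theorem[OF _ _ sequentially_bot])
qed

end

section \<open>Existence of an optimal pair by minimising an explicit function of
  \<open>s\<close>\<close>

theorem theorem3p3:
  fixes \<Omega> :: "'a::euclidean_space set"
    and lam :: "nat \<Rightarrow> real" and e :: "nat \<Rightarrow> 'a \<Rightarrow> real"
    and a b :: real and f ud :: "'a \<Rightarrow> real" and \<phi> :: "real \<Rightarrow> real"
  assumes "open \<Omega>" and "\<Omega> \<noteq> {}" and "bounded \<Omega>" and "convex \<Omega>" and "polytope (closure \<Omega>)"
    and "dirichlet_eigenbasis \<Omega> lam e"
    and "0 \<le> a" and "a < b" and "b \<le> 1"
    and "f \<in> L2 \<Omega>" and "ud \<in> L2 \<Omega>"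
    and "C2_on {a<..<b} \<phi>"
    and "\<And>s. s \<in> {a<..<b} \<Longrightarrow> 0 \<le> \<phi> s"
    and "convex_on {a<..<b} \<phi>"
    and "filterlim \<phi> at_top (at_right a)"
    and "filterlim \<phi> at_top (at_left b)"
  shows "\<exists>sbar\<in>{a<..<b}.
      control_to_state \<Omega> lam e f sbar \<in> Hs \<Omega> lam e sbar \<and>
      optimal_pair \<Omega> lam e f ud \<phi> a b sbar (control_to_state \<Omega> lam e f sbar) \<and>
      (\<forall>s\<in>{a<..<b}. reduced_cost \<Omega> lam e f ud \<phi> sbar \<le> reduced_cost \<Omega> lam e f ud \<phi> s)"
proof -
  have \<Omega>: "\<Omega> \<in> lmeasurable"
    using assms by (intro lmeasurable_open)
  have e: "L2_orthonormal_basis \<Omega> e"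
    using assms by (simp add: dirichlet_eigenbasis_def)
  obtain c where c: "0 < c" "\<And>k. c \<le> lam k"
    using dirichlet_eigenvalues_bounded_below assms by blast
  note ctx = \<Omega> e c assms(10)
  have unit: "0 \<le> s" "s \<le> 1" if "s \<in> {a<..<b}" for s
    using that assms(7-9) by auto
  \<comment> \<open>The reduced cost in terms of coefficients, free of any choice of
    representative.\<close>
  define F where "F s = 1/2 * (\<Sum>k. (lam k powr (- s) * L2_inner \<Omega> f (e k)
      - L2_inner \<Omega> ud (e k))\<^sup>2) + \<phi> s" for s
  have cost: "cost \<Omega> ud \<phi> s v = F s" if "v \<in> L2 \<Omega>" "frac_laplacian \<Omega> lam e s v f" for s v
    using L2_distance_solution[OF ctx that(1) \<open>ud \<in> L2 \<Omega>\<close>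
        frac_laplacian_solution_coefficient[OF ctx that(2)]]
    by (simp add: cost_def F_def)
  have red: "reduced_cost \<Omega> lam e f ud \<phi> s = F s" if "s \<in> {a<..<b}" for s
    unfolding reduced_cost_def
    by (intro cost control_to_state_L2[OF ctx] control_to_state_solves[OF ctx] unit[OF that])
  \<comment> \<open>The tracking term is nonnegative, so \<open>F\<close> inherits the blow-up of
    \<open>\<phi>\<close> at both ends.\<close>
  have ge: "\<phi> s \<le> F s" if "s \<in> {a<..<b}" for s
    unfolding red[OF that, symmetric] by (simp add: reduced_cost_def cost_def)
  have cont: "continuous_on {a<..<b} F"
    unfolding F_def
    \<comment> \<open>Continuity of \<open>\<phi>\<close> is obtained from convexity on an open
      interval.\<close>
    using sums_summable[OF L2_Parseval[OF e \<open>ud \<in> L2 \<Omega>\<close>]] unit \<open>convex_on {a<..<b} \<phi>\<close>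
    by (intro continuous_on_add continuous_on_mult_left convex_on_continuous
        continuous_on_subset[OF continuous_on_tracking_series[OF ctx]]) auto
  have "\<exists>x\<in>{a<..<b}. \<forall>y\<in>{a<..<b}. F x \<le> F y"
  proof (rule continuous_coercive_attains_min[OF \<open>a < b\<close> cont])
    have "\<forall>\<^sub>F s in at_right a. \<phi> s \<le> F s"
      using eventually_at_right_real[OF \<open>a < b\<close>] by eventually_elim (rule ge)
    then show "filterlim F at_top (at_right a)"
      by (rule filterlim_at_top_mono[OF assms(15)])
    have "\<forall>\<^sub>F s in at_left b. \<phi> s \<le> F s"
      using eventually_at_left_real[OF \<open>a < b\<close>] by eventually_elim (rule ge)
    then show "filterlim F at_top (at_left b)"
      by (rule filterlim_at_top_mono[OF assms(16)])
  qed
  then obtain s where s: "s \<in> {a<..<b}" and min: "\<And>t. t \<in> {a<..<b} \<Longrightarrow> F s \<le> F t"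
    by blast
  let ?u = "control_to_state \<Omega> lam e f s"
  have Hs: "?u \<in> Hs \<Omega> lam e s"
    by (rule control_to_state_Hs[OF ctx unit[OF s]])
  have adm: "admissible \<Omega> lam e f a b s ?u"
    using s Hs control_to_state_solves[OF ctx unit[OF s]] by (simp add: admissible_def)
  \<comment> \<open>Comparing admissible pairs thereby reduces to comparing values of
    \<open>F\<close>.\<close>
  have cost_adm: "cost \<Omega> ud \<phi> t v = F t" if "admissible \<Omega> lam e f a b t v" for t v
    using that by (intro cost) (auto simp: admissible_def Hs_def)
  have "optimal_pair \<Omega> lam e f ud \<phi> a b s ?u"
    unfolding optimal_pair_def
  proof (intro conjI allI impI adm)
    fix t v assume v: "admissible \<Omega> lam e f a b t v"
    then have "t \<in> {a<..<b}" by (simp add: admissible_def)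
    then show "cost \<Omega> ud \<phi> s ?u \<le> cost \<Omega> ud \<phi> t v"
      unfolding cost_adm[OF adm] cost_adm[OF v] by (rule min)
  qed
  moreover have "reduced_cost \<Omega> lam e f ud \<phi> s \<le> reduced_cost \<Omega> lam e f ud \<phi> t"
    if "t \<in> {a<..<b}" for t
    unfolding red[OF s] red[OF that] by (rule min[OF that])
  ultimately show ?thesis
    using s Hs by blast
qed

end
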